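(* Let $p$ be an odd prime, $q\in\mathbb{C}_p$ with $|1-q|_p<p^{-1/(p-1)}$, $m\in\mathbb{N}$ and $\alpha,\beta,n\in\mathbb{Z}_+$. Then \[ \frac{g^{(\alpha,\beta)}_{m+1,q}(n)}{m+1}+(-1)^{n-1}\frac{g^{(\alpha,\beta)}_{m+1,q}}{m+1}=[2]_{q^{\beta}}\sum_{l=0}^{n-1}(-1)^{n-l-1}[l]_{q^{\alpha}}^{m}. \]
   Context: $\mathbb{Z}_+=\mathbb{N}\cup\{0\}$. For $q\in\mathbb{C}_p$ with $|1-q|_p<p^{-1/(p-1)}$, $q^x=\exp(x\log q)$ for $|x|_p\le1$, $[x]_q=\frac{1-q^x}{1-q}$, $[x]_{-q}=\frac{1-(-q)^x}{1+q}$. For uniformly differentiable $f:\mathbb{Z}_p\to\mathbb{C}_p$, $\int_{\mathbb{Z}_p}f(x)\,d\mu_{-q}(x)=\lim_{N\to\infty}\frac{1}{[p^N]_{-q}}\sum_{x=0}^{p^N-1}f(x)(-q)^x$; $d\mu_{-q^\beta}$ is the same with $q$ replaced by $q^\beta$. The modified $q$-Genocchi polynomials with weight $(\alpha,\beta)$ are defined by $\frac{g^{(\alpha,\beta)}_{m+1,q}(x)}{m+1}=\int_{\mathbb{Z}_p}q^{-\beta t}[x+t]_{q^{\alpha}}^{m}\,d\mu_{-q^{\beta}}(t)$, and the numbers are $g^{(\alpha,\beta)}_{m+1,q}=g^{(\alpha,\beta)}_{m+1,q}(0)$ (equivalently $\frac{g^{(\alpha,\beta)}_{m+1,q}}{m+1}=\int_{\mathbb{Z}_p}q^{-\beta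 t}[t]_{q^{\alpha}}^{m}\,d\mu_{-q^{\beta}}(t)$). *)

theory Defs
  imports "HOL-Analysis.Analysis" "HOL-Computational_Algebra.Computational_Algebra"
begin

text \<open>The constant \<open>norm\<close> of the library is tied to real normed vector spaces.\<close>

class nonarch_valued_field = field_char_0 + metric_space +
  fixes absv :: "'a \<Rightarrow> real"
  assumes dist_absv: "dist x y = absv (x - y)"
    and absv_mult: "absv (x * y) = absv x * absv y"
    and absv_ultrametric: "absv (x + y) \<le> max (absv x) (absv y)"

text \<open>
  The field of \<open>p\<close>-adic complex numbers is characterised, up to isometric isomorphism, as the
  completion of an algebraic closure of the \<open>p\<close>-adic numbers.  Inside a complete field of
  characteristic 0 whose nonarchimedean absolute value satisfies \<open>|p| = 1/p\<close>, the closure of the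
  rationals is a copy of the \<open>p\<close>-adic numbers; if the ambient field is also algebraically closed,
  the elements algebraic over that copy form its algebraic closure, and their density says
  that the ambient field is the completion of the latter.
\<close>

definition padic_numbers :: "'a :: nonarch_valued_field set" where
  "padic_numbers = closure \<rat>"

definition padic_algebraic :: "'a :: nonarch_valued_field set" where
  "padic_algebraic =
     {x. \<exists>P. P \<noteq> 0 \<and> (\<forall>i. coeff P i \<in> padic_numbers) \<and> poly P x = 0}"

definition is_padic_complex ::
  "nat \<Rightarrow> 'a :: {nonarch_valued_field, alg_closed_field, complete_space} itself \<Rightarrow> bool" where
  "is_padic_complex p (_ :: 'a itself) \<longleftrightarrow>
     prime p \<and> absv (of_nat p :: 'a) = 1 / real p \<and>
     closure (padic_algebraic :: 'a set) = UNIV"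

definition padic_exp :: "'a :: nonarch_valued_field \<Rightarrow> 'a" where
  "padic_exp x = (\<Sum>n. x ^ n / fact n)"

definition padic_log :: "'a :: nonarch_valued_field \<Rightarrow> 'a" where
  "padic_log x = (\<Sum>n. (-1) ^ n * (x - 1) ^ Suc n / of_nat (Suc n))"

text \<open>The power \<open>q\<^sup>x\<close>, meaningful for \<open>|1 - q| < p\<^sup>-\<^sup>1\<^sup>/\<^sup>(\<^sup>p\<^sup>-\<^sup>1\<^sup>)\<close> and \<open>|x| \<le> 1\<close>.\<close>

definition padic_powr :: "'a :: nonarch_valued_field \<Rightarrow> 'a \<Rightarrow> 'a" where
  "padic_powr q x = padic_exp (x * padic_log q)"

text \<open>
  At \<open>q = 1\<close> the quotient is \<open>0 / 0\<close>; as usual it is read as its limit \<open>x\<close>.  This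
  covers the case of weight 0, where \<open>q ^ 0 = 1\<close>.
\<close>

definition q_number :: "'a :: nonarch_valued_field \<Rightarrow> 'a \<Rightarrow> 'a" where
  "q_number q x = (if q = 1 then x else (1 - padic_powr q x) / (1 - q))"

text \<open>
  The number \<open>[x]\<close> with parameter \<open>-q\<close>.  As \<open>-q\<close> is not close to 1, the power \<open>(-q)\<^sup>x\<close> is not
  given by the exponential series; only natural \<open>x\<close> occur, with the ordinary power.
\<close>

definition neg_q_number :: "'a :: nonarch_valued_field \<Rightarrow> nat \<Rightarrow> 'a" where
  "neg_q_number q x = (1 - (- q) ^ x) / (1 + q)"

definition fermionic_integral ::
  "nat \<Rightarrow> 'a :: nonarch_valued_field \<Rightarrow> ('a \<Rightarrow> 'a) \<Rightarrow> 'a" where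
  "fermionic_integral p q f =
     lim (\<lambda>N. 1 / neg_q_number q (p ^ N) * (\<Sum>x<p ^ N. f (of_nat x) * (- q) ^ x))"

text \<open>The factor \<open>k\<close> makes the value at \<open>k = m + 1\<close>, divided by \<open>m + 1\<close>, the defining integral.\<close>

definition genocchi_poly ::
  "nat \<Rightarrow> nat \<Rightarrow> nat \<Rightarrow> nat \<Rightarrow> 'a :: nonarch_valued_field \<Rightarrow> 'a \<Rightarrow> 'a" where
  "genocchi_poly p \<alpha> \<beta> k q x =
     of_nat k * fermionic_integral p (q ^ \<beta>)
       (\<lambda>t. padic_powr q (- of_nat \<beta> * t) * q_number (q ^ \<alpha>) (x + t) ^ (k - 1))"

definition genocchi_number ::
  "nat \<Rightarrow> nat \<Rightarrow> nat \<Rightarrow> nat \<Rightarrow> 'a :: nonarch_valued_field \<Rightarrow> 'a" where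
  "genocchi_number p \<alpha> \<beta> k q = genocchi_poly p \<alpha> \<beta> k q 0"

end

theory Submission
  imports Defs
begin

text \<open>
  For natural \<open>x\<close> the factor \<open>q\<^sup>-\<^sup>\<beta>\<^sup>x\<close> cancels against the weight \<open>q\<^sup>\<beta>\<^sup>x\<close> of the measure, so the integral
  \<open>I(n)\<close> defining the polynomial at \<open>n\<close> is, up to the limit \<open>[2] / 2\<close> of the normalising factors, the
  limit of \<open>\<Sum>x<p\<^sup>N. (-1)\<^sup>x F(n + x)\<close> with \<open>F(x) = [x]\<^sup>m\<close>.  Telescoping gives
  \<open>F(n) + F(n + p\<^sup>N)\<close> for the sum of two such expressions at \<open>n\<close> and \<open>n + 1\<close>, and \<open>F(n + p\<^sup>N)\<close> tends
  to \<open>F(n)\<close>; hence \<open>I(n) + I(n + 1) = [2] F(n)\<close>, which is iterated.  The cancellation needs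
  \<open>exp (log q) = q\<close> on the disc of convergence, and the limits exist because
  \<open>[p\<^sup>N]\<close> tends to 0.
\<close>

unbundle no vec_syntax

section \<open>Nonarchimedean absolute values and series\<close>

lemma absv_dist: "absv x = dist x (0 :: 'a :: nonarch_valued_field)"
  by (simp add: dist_absv)

lemma absv_nonneg [simp]: "absv (x :: 'a :: nonarch_valued_field) \<ge> 0"
  by (simp add: absv_dist)

lemma absv_eq_0 [simp]: "absv (x :: 'a :: nonarch_valued_field) = 0 \<longleftrightarrow> x = 0"
  by (simp add: absv_dist)

lemma absv_zero [simp]: "absv (0 :: 'a :: nonarch_valued_field) = 0"
  by simp

lemma absv_minus [simp]: "absv (- x :: 'a :: nonarch_valued_field) = absv x"
  using dist_absv[of x 0] dist_absv[of 0 x] by (simp add: dist_commute)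

lemma absv_minus_commute: "absv (x - y :: 'a :: nonarch_valued_field) = absv (y - x)"
  by (metis absv_minus minus_diff_eq)

lemma absv_one [simp]: "absv (1 :: 'a :: nonarch_valued_field) = 1"
  using absv_mult[of 1 "1 :: 'a"] absv_eq_0[of "1 :: 'a"] by auto

lemma absv_power [simp]: "absv (x ^ n :: 'a :: nonarch_valued_field) = absv x ^ n"
  by (induction n) (auto simp: absv_mult)

lemma absv_inverse: "absv (inverse x :: 'a :: nonarch_valued_field) = inverse (absv x)"
proof (cases "x = 0")
  case False
  then have "absv x * absv (inverse x) = 1"
    by (simp flip: absv_mult)
  then show ?thesis
    by (metis inverse_unique)
qed auto

lemma absv_divide: "absv (x / y :: 'a :: nonarch_valued_field) = absv x / absv y"
  by (simp add: divide_inverse absv_mult absv_inverse)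

lemma absv_add_le:
  fixes x y :: "'a :: nonarch_valued_field"
  assumes "absv x \<le> C" "absv y \<le> C"
  shows "absv (x + y) \<le> C"
  using absv_ultrametric[of x y] assms by linarith

lemma absv_diff_le:
  fixes x y :: "'a :: nonarch_valued_field"
  assumes "absv x \<le> C" "absv y \<le> C"
  shows "absv (x - y) \<le> C"
  using absv_add_le[of x C "- y"] assms by simp

lemma absv_sum_le:
  fixes f :: "'b \<Rightarrow> 'a :: nonarch_valued_field"
  assumes "C \<ge> 0" "\<And>i. i \<in> A \<Longrightarrow> absv (f i) \<le> C"
  shows "absv (sum f A) \<le> C"
  using assms(2) by (induction A rule: infinite_finite_induct) (auto simp: assms(1) intro!: absv_add_le)

lemma absv_of_nat_le: "absv (of_nat n :: 'a :: nonarch_valued_field) \<le> 1"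
  by (induction n) (auto intro!: absv_add_le)

lemma absv_of_int_le: "absv (of_int n :: 'a :: nonarch_valued_field) \<le> 1"
  by (cases n rule: int_cases2) (auto simp: absv_of_nat_le)

lemma absv_eq_1_if_close:
  fixes x y :: "'a :: nonarch_valued_field"
  assumes "absv y = 1" "absv (x - y) < 1"
  shows "absv x = 1"
proof -
  have "absv x \<le> 1"
    using absv_ultrametric[of "x - y" y] assms by simp
  moreover have "absv y \<le> max (absv (y - x)) (absv x)"
    using absv_ultrametric[of "y - x" x] by simp
  ultimately show ?thesis
    using assms by (simp add: absv_minus_commute[of y x] max_def split: if_splits)
qed

section \<open>Limits and continuity of the field operations\<close>

lemma tendsto_absv_iff:
  fixes f :: "'b \<Rightarrow> 'a :: nonarch_valued_field"
  shows "(f \<longlongrightarrow> l) F \<longleftrightarrow> ((\<lambda>x. absv (f x - l)) \<longlongrightarrow> 0) F"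
  by (subst tendsto_dist_iff) (simp add: dist_absv)

lemma tendsto_absv_le:
  fixes f :: "'b \<Rightarrow> 'a :: nonarch_valued_field"
  assumes "(g \<longlongrightarrow> 0) F" "\<And>x. absv (f x - l) \<le> g x"
  shows "(f \<longlongrightarrow> l) F"
  unfolding tendsto_absv_iff
  by (rule tendsto_sandwich[of "\<lambda>_. 0"]) (use assms in auto)

text \<open>This instance and the next one make the general limit laws for sums, differences and
  products available for the metric given by \<open>absv\<close>.\<close>

instance nonarch_valued_field \<subseteq> topological_ab_group_add
proof
  fix a b :: 'a
  have "((\<lambda>x. fst x + snd x) \<longlongrightarrow> a + b) (nhds a \<times>\<^sub>F nhds b)"
  proof (rule tendsto_absv_le)
    show "((\<lambda>x. absv (fst x - a) + absv (snd x - b)) \<longlongrightarrow> 0) (nhds a \<times>\<^sub>F nhds b)"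
      by (rule tendsto_add_zero; unfold tendsto_absv_iff[symmetric])
        (auto intro: filterlim_fst filterlim_snd)
    fix x :: "'a \<times> 'a"
    have "fst x + snd x - (a + b) = (fst x - a) + (snd x - b)"
      by simp
    then show "absv (fst x + snd x - (a + b)) \<le> absv (fst x - a) + absv (snd x - b)"
      by (metis absv_add_le absv_nonneg le_add_same_cancel1 le_add_same_cancel2)
  qed
  then show "((\<lambda>x. fst x + snd x) \<longlongrightarrow> a + b) (nhds a \<times>\<^sub>F nhds b)" .
  have "((\<lambda>x. absv (x - a)) \<longlongrightarrow> 0) (nhds a)"
    using tendsto_absv_iff[of "\<lambda>x. x" a "nhds a"] by (simp add: filterlim_ident)
  then show "(uminus \<longlongrightarrow> - a) (nhds a)"
    by (rule tendsto_absv_le) (simp add: absv_minus_commute)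
qed

instance nonarch_valued_field \<subseteq> topological_semigroup_mult
proof
  fix a b :: 'a
  let ?F = "nhds a \<times>\<^sub>F nhds b"
  have 1: "((\<lambda>x. absv (fst x - a)) \<longlongrightarrow> 0) ?F" "((\<lambda>x. absv (snd x - b)) \<longlongrightarrow> 0) ?F"
    unfolding tendsto_absv_iff[symmetric] by (auto intro: filterlim_fst filterlim_snd)
  show "((\<lambda>x. fst x * snd x) \<longlongrightarrow> a * b) ?F"
  proof (rule tendsto_absv_le)
    show "((\<lambda>x. absv (fst x - a) * absv (snd x - b) + absv (fst x - a) * absv b
             + absv a * absv (snd x - b)) \<longlongrightarrow> 0) ?F"
      by (auto intro!: tendsto_eq_intros 1)
    fix x :: "'a \<times> 'a"
    \<comment> \<open>Expansion around the point \<open>(a, b)\<close>: every summand has a factor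
      that tends to 0.\<close>
    have "fst x * snd x - a * b
        = (fst x - a) * (snd x - b) + (fst x - a) * b + a * (snd x - b)"
      by (simp add: algebra_simps)
    also have "absv \<dots> \<le> absv (fst x - a) * absv (snd x - b) + absv (fst x - a) * absv b
             + absv a * absv (snd x - b)"
      by (intro absv_add_le; simp add: absv_mult)
    finally show "absv (fst x * snd x - a * b) \<le> absv (fst x - a) * absv (snd x - b)
             + absv (fst x - a) * absv b + absv a * absv (snd x - b)" .
  qed
qed

lemma tendsto_absv:
  fixes f :: "'b \<Rightarrow> 'a :: nonarch_valued_field"
  assumes "(f \<longlongrightarrow> l) F"
  shows "((\<lambda>x. absv (f x)) \<longlongrightarrow> absv l) F"
  unfolding absv_dist by (intro tendsto_intros assms)

section \<open>Cauchy sequences, series and their rearrangement\<close>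

text \<open>By the ultrametric inequality \<open>X n - X M\<close> is no larger than the largest
  step in between, so the number of steps does not matter.\<close>

lemma Cauchy_if_steps_tendsto_0:
  fixes X :: "nat \<Rightarrow> 'a :: nonarch_valued_field"
  assumes "(\<lambda>n. X (Suc n) - X n) \<longlonglongrightarrow> 0"
  shows "Cauchy X"
proof (rule metric_CauchyI)
  fix e :: real assume e: "e > 0"
  have "(\<lambda>n. absv (X (Suc n) - X n)) \<longlonglongrightarrow> 0"
    using tendsto_absv[OF assms] by simp
  then obtain M where M: "absv (X (Suc n) - X n) < e" if "n \<ge> M" for n
    using order_tendstoD(2)[of _ 0 sequentially e] e unfolding eventually_sequentially by blast
  have *: "absv (X n - X M) < e" if "n \<ge> M" for n
    using that
  proof (induction n rule: dec_induct)
    case (step n)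
    then show ?case
      using M[of n] absv_ultrametric[of "X (Suc n) - X n" "X n - X M"] by simp
  qed (simp add: e)
  have "dist (X m) (X n) < e" if "m \<ge> M" "n \<ge> M" for m n
    using *[OF that(1)] *[OF that(2)] absv_ultrametric[of "X m - X M" "X M - X n"]
    by (simp add: dist_absv absv_minus_commute[of "X M" "X n"])
  then show "\<exists>M. \<forall>m\<ge>M. \<forall>n\<ge>M. dist (X m) (X n) < e"
    by blast
qed

lemma summable_if_tendsto_0:
  fixes a :: "nat \<Rightarrow> 'a :: {nonarch_valued_field, complete_space}"
  assumes "a \<longlonglongrightarrow> 0"
  shows "summable a"
proof -
  have "Cauchy (\<lambda>n. \<Sum>i<n. a i)"
    by (rule Cauchy_if_steps_tendsto_0) (simp add: assms)
  then show ?thesis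
    by (simp add: summable_iff_convergent Cauchy_convergent)
qed

text \<open>Finite pieces of the tail satisfy the bound by the ultrametric inequality, and a
  non-strict bound survives the limit.\<close>

lemma absv_series_tail_le:
  fixes a :: "nat \<Rightarrow> 'a :: nonarch_valued_field"
  assumes "a sums S" "C \<ge> 0" "\<And>j. j \<ge> N \<Longrightarrow> absv (a j) \<le> C"
  shows "absv (S - (\<Sum>j<N. a j)) \<le> C"
proof (rule tendsto_upperbound)
  show "(\<lambda>M. absv ((\<Sum>j<M. a j) - (\<Sum>j<N. a j))) \<longlonglongrightarrow> absv (S - (\<Sum>j<N. a j))"
    using assms(1) unfolding sums_def by (intro tendsto_absv tendsto_intros)
  show "\<forall>\<^sub>F M in sequentially. absv ((\<Sum>j<M. a j) - (\<Sum>j<N. a j)) \<le> C"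
    using eventually_ge_at_top[of N]
  proof eventually_elim
    case (elim M)
    have "(\<Sum>j<M. a j) - (\<Sum>j<N. a j) = (\<Sum>j\<in>{..<M} - {..<N}. a j)"
      by (subst sum_diff) (use elim in auto)
    then show ?case
      using assms(2,3) by (auto intro!: absv_sum_le)
  qed
qed auto

lemma summable_if_geometric_bound:
  fixes a :: "nat \<Rightarrow> 'a :: {nonarch_valued_field, complete_space}"
  assumes "0 \<le> s" "s < 1" "\<And>k. absv (a k) \<le> A * s ^ k"
  shows "summable a"
proof (rule summable_if_tendsto_0, rule tendsto_absv_le)
  show "(\<lambda>k. A * s ^ k) \<longlonglongrightarrow> 0"
    using assms(1,2) by (intro tendsto_mult_right_zero LIMSEQ_power_zero) auto
qed (use assms(3) in simp)

text \<open>The product of the partial sums runs over a square, the Cauchy product over the triangle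
  \<open>i + j < N\<close>. The terms in between have \<open>i + j \<ge> N\<close>, so each of them,
  and hence their sum, is at most \<open>A * B * s ^ N\<close>.\<close>

lemma Cauchy_product_geometric_bound:
  fixes a b :: "nat \<Rightarrow> 'a :: nonarch_valued_field"
  assumes s: "0 \<le> s" "s < 1"
    and a: "a sums S" "\<And>k. absv (a k) \<le> A * s ^ k"
    and b: "b sums T" "\<And>k. absv (b k) \<le> B * s ^ k"
  shows "(\<lambda>k. \<Sum>i\<le>k. a i * b (k - i)) sums (S * T)"
proof -
  have AB: "A \<ge> 0" "B \<ge> 0"
    using order_trans[OF absv_nonneg a(2)[of 0]] order_trans[OF absv_nonneg b(2)[of 0]] by simp_all
  let ?C = "\<lambda>N. \<Sum>k<N. \<Sum>i\<le>k. a i * b (k - i)"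
  have "(\<lambda>N. ?C N - (\<Sum>i<N. a i) * (\<Sum>j<N. b j)) \<longlonglongrightarrow> 0"
  proof (rule tendsto_absv_le)
    show "(\<lambda>N. A * B * s ^ N) \<longlonglongrightarrow> 0"
      using s by (intro tendsto_mult_right_zero LIMSEQ_power_zero) auto
    fix N :: nat
    let ?P = "{..<N} \<times> {..<N}" and ?Q = "{(i, j). i + j < N}"
    have sub: "?Q \<subseteq> ?P"
      by auto
    have "?C N = (\<Sum>(i, j)\<in>?Q. a i * b j)"
      by (subst sum.triangle_reindex) simp
    then have "(\<Sum>i<N. a i) * (\<Sum>j<N. b j) - ?C N = (\<Sum>(i, j)\<in>?P - ?Q. a i * b j)"
      by (subst sum_diff[OF _ sub]) (simp_all add: sum_product sum.cartesian_product)
    also have "absv \<dots> \<le> A * B * s ^ N"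
    proof (rule absv_sum_le, goal_cases)
      case (2 x)
      obtain i j where x: "x = (i, j)"
        by fastforce
      have "absv (a i * b j) \<le> (A * s ^ i) * (B * s ^ j)"
        unfolding absv_mult using AB s a(2) b(2) by (intro mult_mono) auto
      also have "\<dots> = A * B * s ^ (i + j)"
        by (simp add: power_add)
      also have "\<dots> \<le> A * B * s ^ N"
        using 2 x AB s by (intro mult_left_mono power_decreasing) auto
      finally show ?case
        by (simp add: x)
    qed (use AB s in simp)
    finally show "absv (?C N - (\<Sum>i<N. a i) * (\<Sum>j<N. b j) - 0) \<le> A * B * s ^ N"
      by (simp add: absv_minus_commute)
  qed
  moreover have "(\<lambda>N. (\<Sum>i<N. a i) * (\<Sum>j<N. b j)) \<longlonglongrightarrow> S * T"
    using a(1) b(1) unfolding sums_def by (intro tendsto_mult)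
  ultimately have "(\<lambda>N. ?C N - (\<Sum>i<N. a i) * (\<Sum>j<N. b j)
      + (\<Sum>i<N. a i) * (\<Sum>j<N. b j)) \<longlonglongrightarrow> 0 + S * T"
    by (rule tendsto_add)
  then show ?thesis
    by (simp add: sums_def)
qed

text \<open>Columns are finite because the array is triangular. Cutting the first \<open>N\<close>
  rows after \<open>N\<close> columns changes each row sum by at most \<open>s ^ N\<close>; since
  the bound is uniform in \<open>n\<close>, the total error is no larger.\<close>

lemma interchange_triangular_sums:
  fixes T :: "nat \<Rightarrow> nat \<Rightarrow> 'a :: nonarch_valued_field"
  assumes s: "0 \<le> s" "s < 1"
    and T: "\<And>n j. absv (T n j) \<le> s ^ j" "\<And>n j. j < n \<Longrightarrow> T n j = 0"
    and R: "\<And>n. T n sums R n"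
    and S: "(\<lambda>j. \<Sum>n\<le>j. T n j) sums S"
  shows "R sums S"
proof -
  let ?C = "\<lambda>N. \<Sum>j<N. \<Sum>n\<le>j. T n j"
  have "(\<lambda>N. (\<Sum>n<N. R n) - ?C N) \<longlonglongrightarrow> 0"
  proof (rule tendsto_absv_le)
    show "(\<lambda>N. s ^ N) \<longlonglongrightarrow> 0"
      using s by (intro LIMSEQ_power_zero) auto
    fix N :: nat
    have "(\<Sum>n\<le>j. T n j) = (\<Sum>n<N. T n j)" if "j < N" for j
      by (rule sum.mono_neutral_left) (use T(2) that in auto)
    then have "?C N = (\<Sum>n<N. \<Sum>j<N. T n j)"
      by (subst sum.swap) simp
    then have "(\<Sum>n<N. R n) - ?C N = (\<Sum>n<N. R n - (\<Sum>j<N. T n j))"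
      by (simp add: sum_subtractf)
    also have "absv \<dots> \<le> s ^ N"
    proof (intro absv_sum_le absv_series_tail_le[OF R])
      fix n j assume "N \<le> j"
      then show "absv (T n j) \<le> s ^ N"
        using T(1)[of n j] s power_decreasing[of N j s] by linarith
    qed (use s in auto)
    finally show "absv ((\<Sum>n<N. R n) - ?C N - 0) \<le> s ^ N"
      by simp
  qed
  then have "(\<lambda>N. (\<Sum>n<N. R n) - ?C N + ?C N) \<longlonglongrightarrow> 0 + S"
    using S unfolding sums_def by (rule tendsto_add)
  then show ?thesis
    by (simp add: sums_def)
qed


section \<open>The \<open>p\<close>-adic exponential and logarithm\<close>

locale padic_valued =
  fixes p :: nat and K :: "'a :: {nonarch_valued_field, complete_space} itself"
  assumes prime_p: "prime p"
    and absv_p: "absv (of_nat p :: 'a) = 1 / real p"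
begin

text \<open>The radius of convergence of the exponential series. Its powers serve as a scale for
  absolute values: \<open>radius ^ k\<close> corresponds to the valuation
  \<open>k / (p - 1)\<close>.\<close>

definition radius :: real where
  "radius = real p powr (- 1 / (real p - 1))"

lemma p_gt_1: "p > 1"
  using prime_p by (rule prime_gt_1_nat)

lemma radius_pos: "radius > 0"
  using p_gt_1 by (simp add: radius_def)

lemma radius_less_1: "radius < 1"
  unfolding radius_def using p_gt_1 by (intro powr_less_one) (auto simp: field_simps)

lemma radius_power: "radius ^ (p - 1) = 1 / real p"
proof -
  have "radius ^ (p - 1) = real p powr (- 1 / (real p - 1) * real (p - 1))"
    using p_gt_1 by (simp add: radius_def powr_power mult.commute)
  also have "- 1 / (real p - 1) * real (p - 1) = - 1"
    using p_gt_1 by (simp add: of_nat_diff)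
  finally show ?thesis
    using p_gt_1 by (simp add: powr_minus_divide)
qed

section \<open>Absolute values of integers and factorials\<close>

text \<open>In a Bezout relation \<open>a * k + b * p = 1\<close> the second summand has absolute
  value at most \<open>1 / p < 1\<close>, so the first must account for the 1.\<close>

lemma absv_of_nat_unit:
  assumes "\<not> p dvd k"
  shows "absv (of_nat k :: 'a) = 1"
proof (rule antisym[OF absv_of_nat_le])
  have "coprime (int k) (int p)"
    using assms prime_imp_coprime[OF prime_p, of k] by (simp add: coprime_commute)
  then obtain a b where "a * int k + b * int p = 1"
    by (metis bezout_int coprime_iff_gcd_eq_1)
  then have "of_int (a * int k + b * int p) = (1 :: 'a)"
    by simp
  then have "1 = absv (of_int a * of_nat k + of_int b * of_nat p :: 'a)"
    by simp
  also have "\<dots> \<le> max (absv (of_int a * of_nat k :: 'a)) (absv (of_int b * of_nat p :: 'a))"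
    by (rule absv_ultrametric)
  also have "\<dots> \<le> max (absv (of_nat k :: 'a)) (1 / real p)"
    unfolding absv_mult absv_p
    by (intro max.mono mult_left_le_one_le) (auto simp: absv_of_int_le)
  finally show "1 \<le> absv (of_nat k :: 'a)"
    using p_gt_1 by (auto simp: max_def split: if_splits)
qed

text \<open>Only the multiples of \<open>p\<close> up to \<open>n\<close> contribute; there are
  \<open>n div p\<close> of them, and dividing each by \<open>p\<close> leaves the factors of
  \<open>fact (n div p)\<close>.\<close>

lemma absv_fact_div:
  "absv (fact n :: 'a) = (1 / real p) ^ (n div p) * absv (fact (n div p) :: 'a)"
proof (induction n)
  case (Suc n)
  show ?case
  proof (cases "p dvd Suc n")
    case True
    then have "Suc n div p = Suc (n div p)" "Suc n = p * (Suc n div p)"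
      by (metis div_Suc dvd_eq_mod_eq_0, metis dvd_mult_div_cancel)
    then have "absv (of_nat (Suc n) :: 'a) = 1 / real p * absv (of_nat (Suc (n div p)) :: 'a)"
      by (metis absv_mult absv_p of_nat_mult)
    then show ?thesis
      using Suc.IH \<open>Suc n div p = _\<close> by (simp add: absv_mult del: of_nat_Suc)
  next
    case False
    then have "Suc n div p = n div p"
      by (auto simp: div_Suc mod_eq_0_iff_dvd)
    then show ?thesis
      using Suc.IH absv_of_nat_unit[OF False] by (simp add: absv_mult del: of_nat_Suc)
  qed
qed auto

text \<open>Legendre's estimate \<open>v\<^sub>p(n!) \<le> (n - 1) / (p - 1)\<close>, by strong induction along \<open>n \<mapsto> n div p\<close>.\<close>

lemma absv_fact_ge:
  assumes "n > 0"
  shows "absv (fact n :: 'a) \<ge> radius ^ (n - 1)"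
  using assms
proof (induction n rule: less_induct)
  case (less n)
  define m where "m = n div p"
  show ?case
  proof (cases "m = 0")
    case True
    then show ?thesis
      using absv_fact_div[of n] radius_pos radius_less_1
      by (simp add: m_def power_le_one)
  next
    case False
    \<comment> \<open>The first part of the exponent becomes \<open>m\<close> factors
      \<open>1 / p\<close> by \<open>radius_power\<close>; the second is the exponent of the
      induction hypothesis for \<open>m\<close>.\<close>
    have "p * m - 1 = (p - 1) * m + (m - 1)"
      using False p_gt_1 by (cases p; cases m) auto
    moreover have "p * m \<le> n"
      by (simp add: m_def)
    ultimately have "radius ^ (n - 1) \<le> radius ^ ((p - 1) * m + (m - 1))"
      using radius_pos radius_less_1 by (intro power_decreasing) auto
    also have "\<dots> = (1 / real p) ^ m * radius ^ (m - 1)"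
      by (simp only: power_add power_mult radius_power)
    also have "\<dots> \<le> (1 / real p) ^ m * absv (fact m :: 'a)"
      using less False p_gt_1 by (intro mult_left_mono) (auto simp: m_def)
    also have "\<dots> = absv (fact n :: 'a)"
      using absv_fact_div[of n] by (simp add: m_def)
    finally show ?thesis .
  qed
qed

lemma absv_fact_ge': "absv (fact n :: 'a) \<ge> radius ^ n"
proof (cases "n = 0")
  case False
  then have "radius ^ n \<le> radius ^ (n - 1)"
    using radius_pos radius_less_1 by (intro power_decreasing) auto
  then show ?thesis
    using absv_fact_ge[of n] False by simp
qed simp

text \<open>The cofactor \<open>fact (n - 1)\<close> of \<open>n\<close> in \<open>fact n\<close> is
  an integer, so \<open>n\<close> is at least as large as \<open>fact n\<close>. This controls the
  denominators of the logarithm.\<close>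

lemma absv_of_nat_ge:
  assumes "n > 0"
  shows "absv (of_nat n :: 'a) \<ge> radius ^ (n - 1)"
proof -
  have "absv (fact n :: 'a) = absv (of_nat n :: 'a) * absv (of_nat (fact (n - 1)) :: 'a)"
    using assms by (simp add: fact_reduce absv_mult)
  also have "\<dots> \<le> absv (of_nat n :: 'a) * 1"
    by (intro mult_left_mono absv_of_nat_le) auto
  finally show ?thesis
    using absv_fact_ge[OF assms] by simp
qed

section \<open>The exponential series\<close>

lemma absv_exp_term_le:
  "absv (x ^ n / fact n :: 'a) \<le> (absv x / radius) ^ n"
  using absv_fact_ge'[of n] radius_pos
  by (auto simp: absv_divide power_divide intro!: frac_le)

lemma padic_exp_sums:
  assumes "absv (x :: 'a) < radius"
  shows "(\<lambda>n. x ^ n / fact n) sums padic_exp x"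
  unfolding padic_exp_def
  by (intro summable_sums summable_if_geometric_bound[of "absv x / radius" _ 1])
    (use assms radius_pos absv_exp_term_le in auto)

lemma padic_exp_add:
  assumes x: "absv (x :: 'a) < radius" and y: "absv y < radius"
  shows "padic_exp (x + y) = padic_exp x * padic_exp y"
proof -
  define s where "s = max (absv x) (absv y) / radius"
  have s: "0 \<le> s" "s < 1"
    using x y radius_pos by (auto simp: s_def le_max_iff_disj)
  have bound: "absv (z ^ k / fact k) \<le> 1 * s ^ k" if "z \<in> {x, y}" for z k
  proof -
    have "absv z / radius \<le> s"
      using that radius_pos by (auto simp: s_def divide_right_mono)
    then have "(absv z / radius) ^ k \<le> s ^ k"
      using radius_pos by (intro power_mono) auto
    then show ?thesis
      using absv_exp_term_le[of z k] by simp
  qed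
  have "(\<lambda>k. \<Sum>i\<le>k. x ^ i / fact i * (y ^ (k - i) / fact (k - i))) sums (padic_exp x * padic_exp y)"
    by (rule Cauchy_product_geometric_bound[OF s padic_exp_sums[OF x] bound padic_exp_sums[OF y] bound])
      auto
  \<comment> \<open>The binomial identity is read off from the formal law for products of
    exponentials, at degree \<open>k\<close>.\<close>
  moreover have "(\<Sum>i\<le>k. x ^ i / fact i * (y ^ (k - i) / fact (k - i))) = (x + y) ^ k / fact k" for k
    using fps_exp_add_mult[of x y, THEN arg_cong[where f = "\<lambda>f. f $ k"]]
    by (simp add: fps_mult_nth atMost_atLeast0)
  moreover have "absv (x + y) < radius"
    using absv_ultrametric[of x y] x y by simp
  ultimately show ?thesis
    using padic_exp_sums sums_unique2 by fastforce
qed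

lemma padic_exp_of_nat_mult:
  assumes "absv (x :: 'a) < radius"
  shows "padic_exp (of_nat k * x) = padic_exp x ^ k"
proof (induction k)
  case 0
  have "(\<lambda>n. 0 ^ n / fact n :: 'a) sums 1"
    using sums_single[of 0 "\<lambda>_. 1 :: 'a"] by (rule sums_cong[THEN iffD1, rotated]) auto
  then show ?case
    by (simp add: padic_exp_def sums_unique[symmetric])
next
  case (Suc k)
  have "absv (of_nat k * x) \<le> absv x"
    unfolding absv_mult by (rule mult_left_le_one_le) (auto simp: absv_of_nat_le)
  then show ?case
    using padic_exp_add[of x "of_nat k * x"] assms Suc.IH by (simp add: algebra_simps)
qed

section \<open>The logarithm and its powers\<close>

text \<open>\<open>fps_ln 1\<close> is the formal logarithm of \<open>1 + X\<close>. The exponent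
  \<open>k - 1\<close>, rather than \<open>k\<close>, in the bound for \<open>k\<close> yields the
  extra factor \<open>radius\<close>, which keeps the logarithm inside the disc and later
  compensates the factorials.\<close>

lemma absv_log_term_le:
  "absv (fps_ln 1 $ k * u ^ k :: 'a) \<le> radius * (absv u / radius) ^ k"
proof (cases "k = 0")
  case False
  have "absv (fps_ln 1 $ k * u ^ k :: 'a) = absv u ^ k / absv (of_nat k :: 'a)"
    using False by (simp add: fps_ln_nth absv_mult absv_divide)
  also have "\<dots> \<le> absv u ^ k / radius ^ (k - 1)"
    using False radius_pos absv_of_nat_ge[of k] by (intro frac_le) auto
  also have "\<dots> = radius * (absv u / radius) ^ k"
    using False radius_pos by (cases k) (auto simp: power_divide)
  finally show ?thesis .
qed (use radius_pos in auto)

text \<open>The series in \<open>padic_log\<close> starts at degree 1; the shift is harmless because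
  \<open>fps_ln 1\<close> has constant term 0.\<close>

lemma padic_log_sums:
  assumes "absv (u :: 'a) < radius"
  shows "(\<lambda>k. fps_ln 1 $ k * u ^ k) sums padic_log (1 + u)"
proof -
  have "summable (\<lambda>k. fps_ln 1 $ k * u ^ k)"
    by (rule summable_if_geometric_bound[OF _ _ absv_log_term_le])
      (use assms radius_pos in auto)
  then have "(\<lambda>N. \<Sum>k<N. fps_ln 1 $ k * u ^ k) \<longlonglongrightarrow> (\<Sum>k. fps_ln 1 $ k * u ^ k)"
    by (simp add: summable_LIMSEQ)
  then have "(\<lambda>N. \<Sum>k<Suc N. fps_ln 1 $ k * u ^ k) \<longlonglongrightarrow> (\<Sum>k. fps_ln 1 $ k * u ^ k)"
    by (rule LIMSEQ_Suc)
  then have "(\<lambda>n. (-1) ^ n * u ^ Suc n / of_nat (Suc n)) sums (\<Sum>k. fps_ln 1 $ k * u ^ k)"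
    unfolding sum.lessThan_Suc_shift by (simp add: sums_def fps_ln_nth)
  then show ?thesis
    using \<open>summable _\<close> by (simp add: padic_log_def sums_iff)
qed

text \<open>Makes the exponential applicable to the logarithm. Strictness survives the limit because
  all terms lie below the common bound \<open>radius * s\<close>, with \<open>s < 1\<close>.\<close>

lemma absv_padic_log_less:
  assumes "absv (u :: 'a) < radius"
  shows "absv (padic_log (1 + u)) < radius"
proof -
  define s where "s = absv u / radius"
  have s: "0 \<le> s" "s < 1"
    using assms radius_pos by (auto simp: s_def)
  have "absv (fps_ln 1 $ j * u ^ j) \<le> radius * s" if "j \<ge> 1" for j
  proof -
    have "s ^ j \<le> s"
      using s that power_decreasing[of 1 j s] by simp
    then have "radius * s ^ j \<le> radius * s"
      using radius_pos by simp
    then show ?thesis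
      using absv_log_term_le[of j u] by (simp add: s_def)
  qed
  \<comment> \<open>Cutting at 1 removes only the vanishing constant term.\<close>
  then have "absv (padic_log (1 + u) - (\<Sum>j<1. fps_ln 1 $ j * u ^ j)) \<le> radius * s"
    using s radius_pos by (intro absv_series_tail_le padic_log_sums assms) auto
  also have "\<dots> < radius"
    using s radius_pos by simp
  finally show ?thesis
    by simp
qed

text \<open>Value and bound are proved together, since the Cauchy product in the induction step
  needs both for exponent \<open>n\<close>.\<close>

lemma padic_log_power_sums:
  assumes u: "absv (u :: 'a) < radius"
  shows "(\<lambda>k. (fps_ln 1 ^ n) $ k * u ^ k) sums (padic_log (1 + u) ^ n)
    \<and> (\<forall>k. absv ((fps_ln 1 ^ n) $ k * u ^ k) \<le> radius ^ n * (absv u / radius) ^ k)"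
proof (induction n)
  case 0
  have "(\<lambda>k. (1 :: 'a fps) $ k * u ^ k) sums 1"
    using sums_single[of 0 "\<lambda>_. 1 :: 'a"] by (rule sums_cong[THEN iffD1, rotated]) auto
  then show ?case
    using radius_pos by auto
next
  case (Suc n)
  let ?s = "absv u / radius"
  let ?l = "fps_ln 1 :: 'a fps"
  have s: "0 \<le> ?s" "?s < 1"
    using u radius_pos by auto
  have conv: "(\<Sum>i\<le>k. (?l $ i * u ^ i) * ((?l ^ n) $ (k - i) * u ^ (k - i))) = (?l ^ Suc n) $ k * u ^ k"
    for k
  proof -
    have "(?l $ i * u ^ i) * ((?l ^ n) $ (k - i) * u ^ (k - i)) = ?l $ i * (?l ^ n) $ (k - i) * u ^ k"
      if "i \<le> k" for i
      using power_add[of u i "k - i"] that by simp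
    then show ?thesis
      by (auto simp: fps_mult_nth atMost_atLeast0 sum_distrib_right intro!: sum.cong)
  qed
  have "(\<lambda>k. \<Sum>i\<le>k. (?l $ i * u ^ i) * ((?l ^ n) $ (k - i) * u ^ (k - i)))
      sums (padic_log (1 + u) * padic_log (1 + u) ^ n)"
    using Suc
    by (intro Cauchy_product_geometric_bound[OF s padic_log_sums[OF u] absv_log_term_le]) auto
  moreover have "absv ((?l ^ Suc n) $ k * u ^ k) \<le> radius ^ Suc n * ?s ^ k" for k
    unfolding conv[symmetric]
  proof (rule absv_sum_le)
    fix i assume "i \<in> {..k}"
    have "absv ((?l $ i * u ^ i) * ((?l ^ n) $ (k - i) * u ^ (k - i)))
        \<le> (radius * ?s ^ i) * (radius ^ n * ?s ^ (k - i))"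
      unfolding absv_mult[of "?l $ i * u ^ i"]
      using Suc s radius_pos by (intro mult_mono absv_log_term_le) auto
    also have "\<dots> = radius ^ Suc n * ?s ^ k"
      using \<open>i \<in> {..k}\<close> by (simp add: power_add[symmetric] del: power_divide)
    finally show "absv ((?l $ i * u ^ i) * ((?l ^ n) $ (k - i) * u ^ (k - i)))
        \<le> radius ^ Suc n * ?s ^ k" .
  qed (use s radius_pos in simp)
  ultimately show ?case
    unfolding conv by simp
qed

text \<open>
  The formal identity \<open>exp (ln (1 + X)) = 1 + X\<close> is evaluated at \<open>u\<close>.  Rearranging the double
  series is harmless because the \<open>j\<close>-th term of the expansion of \<open>ln (1 + u) ^ n / n!\<close> is at most
  \<open>(|u| / radius) ^ j\<close>, uniformly in \<open>n\<close>.
\<close>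

lemma padic_exp_log:
  assumes u: "absv (u :: 'a) < radius"
  shows "padic_exp (padic_log (1 + u)) = 1 + u"
proof -
  let ?s = "absv u / radius"
  let ?l = "fps_ln 1 :: 'a fps"
  define T where "T = (\<lambda>n j. (?l ^ n) $ j * u ^ j / fact n)"
  have s: "0 \<le> ?s" "?s < 1"
    using u radius_pos by auto
  have "absv (T n j) \<le> ?s ^ j" for n j
  proof -
    \<comment> \<open>The factor \<open>radius ^ n\<close> cancels against the lower bound for
      \<open>fact n\<close>, which makes the estimate uniform in \<open>n\<close>.\<close>
    have "absv (T n j) \<le> (radius ^ n * ?s ^ j) / radius ^ n"
      unfolding T_def absv_divide using padic_log_power_sums[OF u, of n] radius_pos s absv_fact_ge'
      by (intro frac_le) auto
    then show ?thesis
      using radius_pos by simp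
  qed
  \<comment> \<open>The formal logarithm has no constant term, so its \<open>n\<close>-th power
    starts at degree \<open>n\<close>.\<close>
  moreover have "T n j = 0" if "j < n" for n j
    using startsby_zero_power_prefix[of ?l n] that by (simp add: T_def)
  moreover have "T n sums (padic_log (1 + u) ^ n / fact n)" for n
  proof -
    have "(\<lambda>N. (\<Sum>k<N. (?l ^ n) $ k * u ^ k) * (1 / fact n)) \<longlonglongrightarrow> padic_log (1 + u) ^ n * (1 / fact n)"
      using padic_log_power_sums[OF u, of n] unfolding sums_def by (intro tendsto_mult) auto
    then show ?thesis
      by (simp add: sums_def T_def sum_divide_distrib)
  qed
  moreover have "(\<lambda>j. \<Sum>n\<le>j. T n j) sums (1 + u)"
  proof -
    \<comment> \<open>\<open>fps_ln 1\<close> is the compositional inverse of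
      \<open>fps_exp 1 - 1\<close>.\<close>
    have "(fps_exp 1 - 1) oo ?l = fps_X"
      by (subst fps_ln_fps_exp_inv) (auto intro!: fps_inv_right)
    then have *: "fps_exp 1 oo ?l = 1 + fps_X"
      by (simp add: fps_compose_sub_distrib algebra_simps)
    have "(\<Sum>n\<le>j. T n j) = (1 + fps_X) $ j * u ^ j" for j
      unfolding *[symmetric] fps_compose_nth
      by (simp add: T_def atMost_atLeast0 sum_distrib_right)
    moreover have "(\<lambda>j. (1 + fps_X) $ j * u ^ j) sums (\<Sum>j\<in>{0, 1}. (1 + fps_X) $ j * u ^ j)"
      by (rule sums_finite) auto
    ultimately show ?thesis
      by simp
  qed
  ultimately have "(\<lambda>n. padic_log (1 + u) ^ n / fact n) sums (1 + u)"
    by (rule interchange_triangular_sums[OF s])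
  then show ?thesis
    by (simp add: padic_exp_def sums_unique[symmetric])
qed


section \<open>Powers and \<open>q\<close>-numbers at natural arguments\<close>

lemma padic_exp_0: "padic_exp (0 :: 'a) = 1"
  using padic_exp_of_nat_mult[of 0 0] radius_pos by simp

lemma padic_powr_of_nat:
  assumes "absv (1 - q :: 'a) < radius"
  shows "padic_powr q (of_nat k) = q ^ k"
  using padic_exp_of_nat_mult[OF absv_padic_log_less[of "q - 1"]] padic_exp_log[of "q - 1"] assms
  by (simp add: padic_powr_def absv_minus_commute)

text \<open>Stated as a product because in this form the integrand cancels against the weight of the
  measure.\<close>

lemma padic_powr_minus_of_nat:
  assumes "absv (1 - q :: 'a) < radius"
  shows "padic_powr q (- of_nat k) * q ^ k = 1"
proof -
  let ?x = "of_nat k * padic_log q"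
  have "absv (padic_log q) < radius"
    using absv_padic_log_less[of "q - 1"] assms by (simp add: absv_minus_commute)
  then have "absv ?x < radius"
    using mult_left_le_one_le[of "absv (padic_log q)" "absv (of_nat k :: 'a)"]
    by (simp add: absv_mult absv_of_nat_le)
  then have "padic_exp (- ?x) * padic_exp ?x = 1"
    by (simp add: padic_exp_add[symmetric] padic_exp_0)
  then show ?thesis
    using padic_powr_of_nat[OF assms, of k] by (simp add: padic_powr_def)
qed

text \<open>The geometric sum also covers the value \<open>k\<close> at \<open>q = 1\<close>, so
  later estimates need neither a case distinction nor a division by \<open>1 - q\<close>.\<close>

lemma q_number_of_nat:
  assumes "absv (1 - q :: 'a) < radius"
  shows "q_number q (of_nat k) = (\<Sum>i<k. q ^ i)"
proof (cases "q = 1")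
  case False
  then show ?thesis
    using assms by (simp add: q_number_def padic_powr_of_nat one_diff_power_eq)
qed (simp add: q_number_def)

end

section \<open>Alternating sums and the fermionic integral\<close>

lemma absv_geometric_sum_le:
  assumes "absv (r :: 'a :: nonarch_valued_field) \<le> 1"
  shows "absv (\<Sum>i<k. r ^ i) \<le> 1"
  using assms by (intro absv_sum_le) (auto simp: power_le_one)

lemma absv_power_diff_one_le:
  assumes "absv (r :: 'a :: nonarch_valued_field) \<le> 1"
  shows "absv (1 - r ^ k) \<le> absv (1 - r)"
  unfolding one_diff_power_eq absv_mult
  using absv_geometric_sum_le[OF assms] by (intro mult_right_le_one_le) auto

lemma absv_power_diff_le:
  fixes a b :: "'a :: nonarch_valued_field"
  assumes "absv a \<le> 1" "absv b \<le> 1"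
  shows "absv (a ^ m - b ^ m) \<le> absv (a - b)"
proof (induction m)
  case (Suc m)
  have "a ^ Suc m - b ^ Suc m = a * (a ^ m - b ^ m) + (a - b) * b ^ m"
    by (simp add: algebra_simps)
  also have "absv \<dots> \<le> absv (a - b)"
  proof (rule absv_add_le)
    show "absv (a * (a ^ m - b ^ m)) \<le> absv (a - b)"
      using mult_left_le_one_le[of "absv (a ^ m - b ^ m)" "absv a"] assms Suc.IH
      by (simp add: absv_mult)
    show "absv ((a - b) * b ^ m) \<le> absv (a - b)"
      using assms by (auto simp: absv_mult power_le_one intro!: mult_right_le_one_le)
  qed
  finally show ?case .
qed simp

lemma geometric_sum_add:
  "(\<Sum>i<a + b. r ^ i) = (\<Sum>i<a. r ^ i) + r ^ a * (\<Sum>i<b. r ^ i :: 'a :: comm_semiring_1)"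
  by (induction b) (simp_all add: distrib_left power_add add.assoc)

lemma geometric_sum_mult:
  "(\<Sum>i<M * k. r ^ i) = (\<Sum>i<M. r ^ i) * (\<Sum>j<k. (r ^ M) ^ j :: 'a :: comm_semiring_1)"
proof (induction k)
  case (Suc k)
  have "(\<Sum>i<M * Suc k. r ^ i) = (\<Sum>i<M * k + M. r ^ i)"
    by (simp add: add.commute)
  then show ?case
    using Suc.IH by (simp add: geometric_sum_add power_mult distrib_left mult.commute)
qed simp

lemma sum_lessThan_mult:
  fixes g :: "nat \<Rightarrow> 'a :: comm_monoid_add"
  shows "(\<Sum>x<k * M. g x) = (\<Sum>j<k. \<Sum>x<M. g (x + j * M))"
proof -
  have "(\<Sum>j<k. sum g {j * M..<j * M + M}) = (\<Sum>j<k. \<Sum>x<M. g (x + j * M))"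
    by (simp add: sum.atLeastLessThan_shift_0[of g "_ * M"] atLeast0LessThan add.commute)
  then show ?thesis
    by (simp add: sum.nat_group)
qed

lemma alternating_sum_Suc:
  fixes f :: "nat \<Rightarrow> 'a :: comm_ring_1"
  shows "(\<Sum>x<M. (-1) ^ x * f x) + (\<Sum>x<M. (-1) ^ x * f (Suc x)) = f 0 - (-1) ^ M * f M"
  by (induction M) (simp_all add: algebra_simps)

lemma alternating_sum_odd:
  assumes "odd k"
  shows "(\<Sum>j<k. (-1) ^ j) = (1 :: 'a :: comm_ring_1)"
proof -
  have "(\<Sum>j<k. (-1) ^ j :: 'a) = (if odd k then 1 else 0)" for k
    by (induction k) auto
  then show ?thesis
    using assms by simp
qed

context padic_valued
begin

text \<open>Grouping in blocks writes the sum as a product of \<open>N\<close> factors of the form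
  \<open>\<Sum>j<p. s ^ j\<close>. Such a factor differs from \<open>p\<close> by terms
  \<open>1 - s ^ j\<close>, each at most \<open>absv (1 - r)\<close>.\<close>

lemma absv_geometric_sum_prime_power_le:
  assumes r: "absv (1 - r :: 'a) < 1"
  shows "absv (\<Sum>i<p ^ N. r ^ i) \<le> max (1 / real p) (absv (1 - r)) ^ N"
proof (induction N)
  case (Suc N)
  have "absv r = 1"
    using absv_eq_1_if_close[of 1 r] r by (simp add: absv_minus_commute)
  define s where "s = r ^ (p ^ N)"
  have s: "absv s \<le> 1" "absv (1 - s) \<le> absv (1 - r)"
    using absv_power_diff_one_le[of r] \<open>absv r = 1\<close> by (auto simp: s_def)
  have "(\<Sum>j<p. s ^ j) = of_nat p - (\<Sum>j<p. 1 - s ^ j)"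
    by (simp add: sum_subtractf)
  also have "absv \<dots> \<le> max (1 / real p) (absv (1 - r))"
    using order_trans[OF absv_power_diff_one_le[OF s(1)] s(2)]
    by (intro absv_diff_le[OF _ absv_sum_le]) (auto simp: absv_p le_max_iff_disj)
  finally have "absv (\<Sum>j<p. s ^ j) \<le> max (1 / real p) (absv (1 - r))" .
  moreover have "(\<Sum>i<p ^ Suc N. r ^ i) = (\<Sum>j<p. s ^ j) * (\<Sum>i<p ^ N. r ^ i)"
    using geometric_sum_mult[where M = "p ^ N" and k = p and r = r] by (simp add: s_def mult.commute)
  ultimately show ?case
    using Suc.IH by (auto simp: absv_mult le_max_iff_disj intro!: mult_mono)
qed simp

lemma geometric_sum_prime_power_bound_tendsto:
  assumes "absv (1 - r :: 'a) < 1"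
  shows "(\<lambda>N. max (1 / real p) (absv (1 - r)) ^ N) \<longlonglongrightarrow> 0"
  using assms p_gt_1 by (intro LIMSEQ_power_zero) (auto simp: abs_if less_max_iff_disj)

lemma power_prime_power_tendsto_1:
  assumes r: "absv (1 - r :: 'a) < 1"
  shows "(\<lambda>N. r ^ (p ^ N)) \<longlonglongrightarrow> 1"
proof (rule tendsto_absv_le[OF geometric_sum_prime_power_bound_tendsto[OF r]])
  fix N
  have "absv (r ^ (p ^ N) - 1) = absv (1 - r) * absv (\<Sum>i<p ^ N. r ^ i)"
    by (simp add: absv_minus_commute[of _ 1] one_diff_power_eq absv_mult)
  also have "\<dots> \<le> absv (\<Sum>i<p ^ N. r ^ i)"
    using r by (intro mult_left_le_one_le) auto
  also have "\<dots> \<le> max (1 / real p) (absv (1 - r)) ^ N"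
    by (rule absv_geometric_sum_prime_power_le[OF r])
  finally show "absv (r ^ (p ^ N) - 1) \<le> max (1 / real p) (absv (1 - r)) ^ N" .
qed

text \<open>Without the exponent \<open>m\<close> the difference is \<open>r ^ x\<close> times the
  sum of length \<open>p ^ N\<close> times a factor of absolute value at most 1. The bound is
  uniform in \<open>x\<close> and \<open>j\<close>, as the convergence proof requires.\<close>

lemma absv_geometric_sum_power_shift_le:
  assumes r: "absv (1 - r :: 'a) < 1"
  shows "absv ((\<Sum>i<x + j * p ^ N. r ^ i) ^ m - (\<Sum>i<x. r ^ i) ^ m)
    \<le> max (1 / real p) (absv (1 - r)) ^ N"
proof -
  have r1: "absv r = 1"
    using absv_eq_1_if_close[of 1 r] r by (simp add: absv_minus_commute)
  have "absv ((\<Sum>i<x + j * p ^ N. r ^ i) ^ m - (\<Sum>i<x. r ^ i) ^ m)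
      \<le> absv ((\<Sum>i<x + j * p ^ N. r ^ i) - (\<Sum>i<x. r ^ i))"
    using r1 by (intro absv_power_diff_le absv_geometric_sum_le) auto
  also have "\<dots> = absv (\<Sum>i<p ^ N. r ^ i) * absv (\<Sum>i<j. (r ^ (p ^ N)) ^ i)"
    using r1 by (simp add: geometric_sum_add mult.commute[of j] geometric_sum_mult absv_mult)
  also have "\<dots> \<le> absv (\<Sum>i<p ^ N. r ^ i)"
    using r1 by (intro mult_right_le_one_le absv_geometric_sum_le) auto
  also have "\<dots> \<le> max (1 / real p) (absv (1 - r)) ^ N"
    by (rule absv_geometric_sum_prime_power_le[OF r])
  finally show ?thesis .
qed

text \<open>The sum of length \<open>p ^ Suc N\<close> splits into \<open>p\<close> blocks with
  signs \<open>(-1) ^ j\<close>. These signs add up to 1 for odd \<open>p\<close>, so the shorter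
  sum can be subtracted block by block.\<close>

lemma alternating_sums_convergent:
  fixes f :: "nat \<Rightarrow> 'a"
  assumes "odd p" and e: "e \<longlonglongrightarrow> 0"
    and f: "\<And>N x j. absv (f (x + j * p ^ N) - f x) \<le> e N"
  shows "convergent (\<lambda>N. \<Sum>x<p ^ N. (-1) ^ x * f x)"
proof (rule Cauchy_convergent, rule Cauchy_if_steps_tendsto_0, rule tendsto_absv_le[OF e])
  fix N
  let ?M = "p ^ N"
  have "e N \<ge> 0"
    using order_trans[OF absv_nonneg f[of 0 0 N]] .
  \<comment> \<open>\<open>p ^ N\<close> is odd, so moving on by one block flips the sign.\<close>
  have sign: "(-1) ^ (x + j * ?M) = (-1) ^ j * (-1 :: 'a) ^ x" for x j
    using \<open>odd p\<close> by (simp add: power_add power_mult mult.commute[of j])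
  have "(\<Sum>x<p ^ Suc N. (-1) ^ x * f x) = (\<Sum>j<p. \<Sum>x<?M. (-1) ^ j * (-1) ^ x * f (x + j * ?M))"
    by (simp only: power_Suc sum_lessThan_mult sign)
  moreover have "(\<Sum>x<?M. (-1) ^ x * f x) = (\<Sum>j<p. (-1) ^ j) * (\<Sum>x<?M. (-1) ^ x * f x)"
    using \<open>odd p\<close> by (simp add: alternating_sum_odd)
  then have "(\<Sum>x<?M. (-1) ^ x * f x) = (\<Sum>j<p. \<Sum>x<?M. (-1) ^ j * (-1) ^ x * f x)"
    by (simp add: sum_product mult.assoc)
  ultimately have "(\<Sum>x<p ^ Suc N. (-1) ^ x * f x) - (\<Sum>x<?M. (-1) ^ x * f x)
      = (\<Sum>j<p. \<Sum>x<?M. (-1) ^ j * (-1) ^ x * (f (x + j * ?M) - f x))"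
    by (simp only: sum_subtractf right_diff_distrib)
  also have "absv \<dots> \<le> e N"
    using \<open>e N \<ge> 0\<close> f by (intro absv_sum_le) (auto simp: absv_mult)
  finally show "absv ((\<Sum>x<p ^ Suc N. (-1) ^ x * f x) - (\<Sum>x<?M. (-1) ^ x * f x) - 0) \<le> e N"
    by simp
qed

lemma absv_two:
  assumes "odd p"
  shows "absv (2 :: 'a) = 1"
proof -
  have "\<not> p dvd 2"
  proof
    assume "p dvd 2"
    then have "p \<le> 2"
      by (rule dvd_imp_le) simp
    then have "p = 2"
      using p_gt_1 by simp
    then show False
      using assms by simp
  qed
  then show ?thesis
    using absv_of_nat_unit[of 2] by simp
qed

text \<open>As \<open>p ^ N\<close> is odd, \<open>neg_q_number Q (p ^ N)\<close> equals
  \<open>(1 + Q ^ (p ^ N)) / (1 + Q)\<close>. Its numerator tends to 2, which is a unit for odd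
  \<open>p\<close>.\<close>

lemma inverse_neg_q_number_tendsto:
  assumes "odd p" and Q: "absv (1 - Q :: 'a) < 1"
  shows "(\<lambda>N. 1 / neg_q_number Q (p ^ N)) \<longlonglongrightarrow> (1 + Q) / 2"
proof (rule tendsto_absv_le)
  have "(\<lambda>N. absv (Q ^ (p ^ N) - 1)) \<longlonglongrightarrow> 0"
    using power_prime_power_tendsto_1[OF Q] by (simp add: tendsto_absv_iff)
  then show "(\<lambda>N. absv (1 + Q) * absv (Q ^ (p ^ N) - 1)) \<longlonglongrightarrow> 0"
    by (rule tendsto_mult_right_zero)
  fix N
  let ?y = "Q ^ (p ^ N)"
  have "absv Q = 1"
    using absv_eq_1_if_close[of 1 Q] Q by (simp add: absv_minus_commute)
  then have "absv (1 - ?y) < 1"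
    using absv_power_diff_one_le[of Q "p ^ N"] Q by simp
  \<comment> \<open>\<open>1 + ?y\<close> is closer than 1 to the unit 2.\<close>
  then have 1: "absv (1 + ?y) = 1"
    using absv_eq_1_if_close[OF absv_two[OF \<open>odd p\<close>], of "1 + ?y"]
    by (simp add: absv_minus_commute[of ?y 1])
  then have "1 + ?y \<noteq> 0"
    by (metis absv_zero zero_neq_one)
  then have "1 / neg_q_number Q (p ^ N) - (1 + Q) / 2 = (1 + Q) * (1 - ?y) / (2 * (1 + ?y))"
    using \<open>odd p\<close> by (simp add: neg_q_number_def power_minus_odd field_simps)
  also have "absv \<dots> = absv (1 + Q) * absv (?y - 1)"
    unfolding absv_divide absv_mult 1 absv_two[OF \<open>odd p\<close>] by (simp add: absv_minus_commute)
  finally show "absv (1 / neg_q_number Q (p ^ N) - (1 + Q) / 2) \<le> absv (1 + Q) * absv (?y - 1)"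
    by simp
qed

section \<open>Genocchi polynomials at natural arguments\<close>

lemma genocchi_poly_of_nat_tendsto:
  fixes q :: 'a and \<alpha> \<beta> m n :: nat
  assumes "odd p" and q: "absv (1 - q) < radius"
  defines "S \<equiv> (\<lambda>n N. \<Sum>x<p ^ N. (-1) ^ x * q_number (q ^ \<alpha>) (of_nat (n + x)) ^ m)"
  shows "convergent (S n)"
    and "genocchi_poly p \<alpha> \<beta> (m + 1) q (of_nat n) / of_nat (m + 1) = (1 + q ^ \<beta>) / 2 * lim (S n)"
proof -
  have q1: "absv (1 - q) < 1"
    using q radius_less_1 by simp
  then have "absv q = 1"
    using absv_eq_1_if_close[of 1 q] by (simp add: absv_minus_commute)
  then have close: "absv (1 - q ^ k) \<le> absv (1 - q)" for k
    by (simp add: absv_power_diff_one_le)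
  have Q: "absv (1 - q ^ \<beta>) < 1"
    using close[of \<beta>] q1 by simp
  have r: "absv (1 - q ^ \<alpha>) < 1" "absv (1 - q ^ \<alpha>) < radius"
    using close[of \<alpha>] q1 q by simp_all
  show conv: "convergent (S n)"
    unfolding S_def
  proof (rule alternating_sums_convergent[OF \<open>odd p\<close> geometric_sum_prime_power_bound_tendsto[OF r(1)]])
    fix N x j
    show "absv (q_number (q ^ \<alpha>) (of_nat (n + (x + j * p ^ N))) ^ m
        - q_number (q ^ \<alpha>) (of_nat (n + x)) ^ m) \<le> max (1 / real p) (absv (1 - q ^ \<alpha>)) ^ N"
      unfolding q_number_of_nat[OF r(2)] add.assoc[symmetric]
      by (rule absv_geometric_sum_power_shift_le[OF r(1)])
  qed
  have "padic_powr q (- of_nat \<beta> * of_nat x) * q_number (q ^ \<alpha>) (of_nat n + of_nat x) ^ (m + 1 - 1)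
      * (- (q ^ \<beta>)) ^ x = (-1) ^ x * q_number (q ^ \<alpha>) (of_nat (n + x)) ^ m" for x
  proof -
    have "padic_powr q (- of_nat \<beta> * of_nat x) * (q ^ \<beta>) ^ x = 1"
      using padic_powr_minus_of_nat[OF q, of "\<beta> * x"] by (simp add: power_mult)
    then show ?thesis
      by (simp add: power_minus[of "q ^ \<beta>"] mult_ac)
  qed
  \<comment> \<open>The factor \<open>m + 1\<close> from the definition cancels because the field
    has characteristic 0.\<close>
  then have "genocchi_poly p \<alpha> \<beta> (m + 1) q (of_nat n) / of_nat (m + 1)
      = lim (\<lambda>N. 1 / neg_q_number (q ^ \<beta>) (p ^ N) * S n N)"
    unfolding genocchi_poly_def fermionic_integral_def S_def by (simp del: of_nat_Suc of_nat_add)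
  moreover have "(\<lambda>N. 1 / neg_q_number (q ^ \<beta>) (p ^ N) * S n N) \<longlonglongrightarrow> (1 + q ^ \<beta>) / 2 * lim (S n)"
    using conv by (intro tendsto_mult inverse_neg_q_number_tendsto \<open>odd p\<close> Q) (simp add: convergent_LIMSEQ_iff)
  ultimately show "genocchi_poly p \<alpha> \<beta> (m + 1) q (of_nat n) / of_nat (m + 1)
      = (1 + q ^ \<beta>) / 2 * lim (S n)"
    by (simp add: limI)
qed

lemma genocchi_poly_Suc:
  fixes q :: 'a and \<alpha> \<beta> m n :: nat
  assumes "odd p" and q: "absv (1 - q) < radius"
  shows "genocchi_poly p \<alpha> \<beta> (m + 1) q (of_nat n) / of_nat (m + 1)
      + genocchi_poly p \<alpha> \<beta> (m + 1) q (of_nat (Suc n)) / of_nat (m + 1)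
    = q_number (q ^ \<beta>) 2 * q_number (q ^ \<alpha>) (of_nat n) ^ m"
proof -
  let ?F = "\<lambda>x. q_number (q ^ \<alpha>) (of_nat x) ^ m"
  let ?S = "\<lambda>n N. \<Sum>x<p ^ N. (-1) ^ x * ?F (n + x)"
  have q1: "absv (1 - q) < 1"
    using q radius_less_1 by simp
  then have "absv q = 1"
    using absv_eq_1_if_close[of 1 q] by (simp add: absv_minus_commute)
  then have close: "absv (1 - q ^ k) \<le> absv (1 - q)" for k
    by (simp add: absv_power_diff_one_le)
  have r: "absv (1 - q ^ \<alpha>) < 1" "absv (1 - q ^ \<alpha>) < radius"
    and Q: "absv (1 - q ^ \<beta>) < radius"
    using close[of \<alpha>] close[of \<beta>] q1 q by simp_all
  note lim = genocchi_poly_of_nat_tendsto[OF \<open>odd p\<close> q]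
  \<comment> \<open>The end term gets a plus sign since \<open>p ^ N\<close> is odd;
    \<open>1 * p ^ N\<close> matches the shift \<open>j * p ^ N\<close> with
    \<open>j = 1\<close>.\<close>
  have "?S n N + ?S (Suc n) N = ?F n + ?F (n + 1 * p ^ N)" for N
    using alternating_sum_Suc[of "\<lambda>x. ?F (n + x)" "p ^ N"] \<open>odd p\<close> by simp
  moreover have "(\<lambda>N. ?F (n + 1 * p ^ N)) \<longlonglongrightarrow> ?F n"
    unfolding q_number_of_nat[OF r(2)]
    by (rule tendsto_absv_le[OF geometric_sum_prime_power_bound_tendsto[OF r(1)]
          absv_geometric_sum_power_shift_le[OF r(1)]])
  ultimately have "(\<lambda>N. ?S n N + ?S (Suc n) N) \<longlonglongrightarrow> ?F n + ?F n"
    by (simp only:) (intro tendsto_add tendsto_const)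
  moreover have "(\<lambda>N. ?S n N + ?S (Suc n) N) \<longlonglongrightarrow> lim (?S n) + lim (?S (Suc n))"
    using lim(1) by (intro tendsto_add) (simp_all only: convergent_LIMSEQ_iff)
  ultimately have "lim (?S n) + lim (?S (Suc n)) = 2 * ?F n"
    using LIMSEQ_unique by fastforce
  \<comment> \<open>The normalising limit is thus half of this number, and the half cancels the 2 in
    \<open>2 * ?F n\<close>.\<close>
  moreover have "q_number (q ^ \<beta>) 2 = 1 + q ^ \<beta>"
    using q_number_of_nat[OF Q, of 2] by (simp add: numeral_2_eq_2)
  ultimately show ?thesis
    unfolding lim(2) distrib_left[symmetric] by simp
qed

end

theorem theorem3:
  fixes q :: "'a :: {nonarch_valued_field, alg_closed_field, complete_space}"
    and p m \<alpha> \<beta> n :: nat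
  assumes "is_padic_complex p TYPE('a)"
    and "prime p" and "odd p"
    and "absv (1 - q) < real p powr (- 1 / (real p - 1))"
    and "m \<ge> 1"
  shows "genocchi_poly p \<alpha> \<beta> (m + 1) q (of_nat n) / of_nat (m + 1)
           + (-1) powi (int n - 1) * (genocchi_number p \<alpha> \<beta> (m + 1) q / of_nat (m + 1))
         = q_number (q ^ \<beta>) 2
             * (\<Sum>l<n. (-1) ^ (n - l - 1) * q_number (q ^ \<alpha>) (of_nat l) ^ m)"
proof -
  interpret padic_valued p "TYPE('a)"
    using assms(1,2) by unfold_locales (auto simp: is_padic_complex_def)
  have q: "absv (1 - q) < radius"
    using assms(4) by (simp add: radius_def)
  define I where "I = (\<lambda>n. genocchi_poly p \<alpha> \<beta> (m + 1) q (of_nat n) / of_nat (m + 1))"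
  define c where "c = q_number (q ^ \<beta>) 2"
  define F where "F = (\<lambda>l. q_number (q ^ \<alpha>) (of_nat l) ^ m)"
  have I_Suc: "I (Suc n) = c * F n - I n" for n
    using genocchi_poly_Suc[OF \<open>odd p\<close> q, of \<alpha> \<beta> m n] unfolding I_def c_def F_def
    by (simp add: eq_diff_eq add.commute)
  have "I n - (-1) ^ n * I 0 = c * (\<Sum>l<n. (-1) ^ (n - l - 1) * F l)"
  proof (induction n)
    case (Suc n)
    \<comment> \<open>For \<open>l < n\<close> the natural number \<open>n - l\<close> is positive,
      so one factor \<open>-1\<close> can be split off.\<close>
    have "(\<Sum>l<n. (-1) ^ (n - l) * F l) = - (\<Sum>l<n. (-1) ^ (n - l - 1) * F l)"
      unfolding sum_negf[symmetric]
      by (intro sum.cong refl) (simp add: power_eq_if)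
    then have "c * (\<Sum>l<Suc n. (-1) ^ (Suc n - l - 1) * F l)
        = c * F n - c * (\<Sum>l<n. (-1) ^ (n - l - 1) * F l)"
      by (simp add: algebra_simps)
    then show ?case
      unfolding Suc.IH[symmetric] I_Suc by simp
  qed simp
  \<comment> \<open>With an integer exponent this also holds at \<open>n = 0\<close>, where the sign
    is \<open>-1\<close> and both sides of the theorem vanish.\<close>
  moreover have "(-1) powi (int n - 1) = - ((-1 :: 'a) ^ n)"
    by (simp add: power_int_diff)
  ultimately show ?thesis
    by (simp add: I_def c_def F_def genocchi_number_def del: of_nat_Suc)
qed

end
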